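(* For every integer $k \ge 0$ there exists a tournament $T_k$ on $3^k$ vertices in which every vertex has out-degree $\frac{3^k-1}{2}$, and such that for every set $X \subseteq V(T_k)$ of size $|X| \le \frac{3^k-1}{2}$ we have $$\delta^+(T_k[X]) \le \frac{\frac{3^k-1}{2} - k}{2}.$$
   Context: Digraphs have no loops or parallel arcs. A tournament is a digraph in which for every pair of distinct vertices $u,v$ exactly one of the arcs $(u,v)$, $(v,u)$ is present. For $X \subseteq V(D)$, $D[X]$ denotes the subdigraph induced by $X$ (vertex set $X$ and all arcs of $D$ between vertices of $X$). $\delta^+(D)$ denotes the minimum out-degree of $D$ (the smallest out-degree among its vertices), defined as $0$ when $D$ is the empty digraph. *)

theory Defs
  imports Complex_Main "Graph_Theory.Graph_Theory"
begin

locale tournament = digraph +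
  assumes exactly_one_arc:
    "\<lbrakk>u \<in> verts G; v \<in> verts G; u \<noteq> v\<rbrakk> \<Longrightarrow> (u \<rightarrow>\<^bsub>G\<^esub> v) \<noteq> (v \<rightarrow>\<^bsub>G\<^esub> u)"

definition min_out_degree :: "('a, 'b) pre_digraph \<Rightarrow> nat" where
  "min_out_degree G = (if verts G = {} then 0 else Min (out_degree G ` verts G))"

end

theory Submission
  imports Defs
begin

text \<open>The tournament \<open>T\<^sub>k\<close> is the \<open>k\<close>-fold lexicographic power of the cyclic triangle. Write
  \<open>h = (3\<^sup>k - 1) / 2\<close>. A set \<open>X\<close> in \<open>T\<^sub>k\<^sub>+\<^sub>1\<close> splits into parts of sizes \<open>a\<^sub>0, a\<^sub>1, a\<^sub>2\<close> lying in
  three copies of \<open>T\<^sub>k\<close>, and a vertex of part \<open>i\<close> gains \<open>a\<^sub>i\<^sub>+\<^sub>1\<close> out-neighbours from the next part.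
  If some nonempty part is followed by an empty one, the out-degrees there are at most \<open>h\<close>, which is
  enough. Otherwise \<open>a\<^sub>0 + a\<^sub>1 + a\<^sub>2 \<le> 3h + 1\<close> yields an \<open>i\<close> with \<open>max h a\<^sub>i + a\<^sub>i\<^sub>+\<^sub>1 \<le> 2h\<close>, and
  the induction hypothesis for part \<open>i\<close> finishes; parts with more than \<open>h\<close> vertices are
  covered because adding a vertex raises the minimum out-degree by at most one.\<close>

section \<open>The dominance relation on base 3 expansions\<close>

text \<open>The least significant base 3 digit is the coordinate in the outermost triangle.\<close>

function beats :: "nat \<Rightarrow> nat \<Rightarrow> bool" where
  "beats u v \<longleftrightarrow>
     (if u = v then False
      else if u mod 3 = v mod 3 then beats (u div 3) (v div 3)
      else v mod 3 = Suc u mod 3)"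
  by auto
termination
  \<comment> \<open>Distinct arguments are not both 0, so dropping the last digit lowers their
    sum.\<close>
  by (relation "measure (\<lambda>(u, v). u + v)") auto

declare beats.simps [simp del]

lemma beats_irrefl [simp]: "\<not> beats u u"
  by (simp add: beats.simps)

lemma beats_exactly_one: "u \<noteq> v \<Longrightarrow> beats u v \<noteq> beats v u"
proof (induction u v rule: beats.induct)
  case (1 u v)
  show ?case
  proof (cases "u mod 3 = v mod 3")
    case True
    with \<open>u \<noteq> v\<close> have "u div 3 \<noteq> v div 3"
      by (metis div_mult_mod_eq)
    with 1 True show ?thesis
      by (simp add: beats.simps[of u v] beats.simps[of v u])
  next
    case False
    \<comment> \<open>Distinct residues modulo 3 differ by 1 or by -1, which makes exactly one of
      them the cyclic successor of the other.\<close>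
    moreover have "(b = Suc a mod 3) \<noteq> (a = Suc b mod 3)"
      if "a < 3" "b < 3" "a \<noteq> b" for a b :: nat
    proof -
      have "a = 0 \<or> a = 1 \<or> a = 2" "b = 0 \<or> b = 1 \<or> b = 2" using that by linarith+
      then show ?thesis using \<open>a \<noteq> b\<close> by (elim disjE) simp_all
    qed
    ultimately have "(v mod 3 = Suc (u mod 3) mod 3) \<noteq> (u mod 3 = Suc (v mod 3) mod 3)"
      by (metis mod_less_divisor zero_less_numeral)
    then have "(v mod 3 = Suc u mod 3) \<noteq> (u mod 3 = Suc v mod 3)"
      unfolding mod_Suc_eq .
    with False \<open>u \<noteq> v\<close> show ?thesis
      by (simp add: beats.simps[of u v] beats.simps[of v u])
  qed
qed

lemma beats_digit:
  assumes "i < 3" "j < 3"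
  shows "beats (3 * u + i) (3 * v + j) \<longleftrightarrow> (if i = j then beats u v else j = Suc i mod 3)"
proof -
  have "Suc (3 * u + i) mod 3 = Suc i mod 3" by presburger
  moreover have "3 * u + i = 3 * v + j \<longleftrightarrow> u = v \<and> i = j"
    using assms by presburger
  ultimately show ?thesis
    using assms by (simp add: beats.simps[of "3 * u + i"])
qed

section \<open>Out-neighbourhoods split by the last digit\<close>

definition beaten :: "nat set \<Rightarrow> nat \<Rightarrow> nat set" where
  "beaten X v = {w \<in> X. beats v w}"

lemma finite_beaten [simp]: "finite X \<Longrightarrow> finite (beaten X v)"
  by (simp add: beaten_def)

text \<open>Dropping the last digit renumbers each copy as \<open>T\<^sub>k\<close> itself, so an
  induction hypothesis applies without an isomorphism.\<close>

definition part :: "nat set \<Rightarrow> nat \<Rightarrow> nat set" where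
  "part X i = {w. 3 * w + i \<in> X}"

lemma finite_part [simp]: "finite X \<Longrightarrow> finite (part X i)"
  unfolding part_def by (rule finite_vimageI[of X "\<lambda>w. 3 * w + i", unfolded vimage_def]) (auto simp: inj_on_def)

lemma part_subset: "i < 3 \<Longrightarrow> X \<subseteq> {..<3 ^ Suc k} \<Longrightarrow> part X i \<subseteq> {..<3 ^ k}"
  by (fastforce simp: part_def subset_iff)

lemma part_lessThan: "i < 3 \<Longrightarrow> part {..<3 ^ Suc k} i = {..<3 ^ k}"
  by (auto simp: part_def)

lemma card_parts:
  assumes "finite X"
  shows "card X = card (part X 0) + card (part X 1) + card (part X 2)"
proof -
  let ?I = "\<lambda>i. (\<lambda>w. 3 * w + i) ` part X i"
  have X: "X = ?I 0 \<union> ?I 1 \<union> ?I 2"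
  proof (intro equalityI subsetI)
    fix x assume "x \<in> X"
    then have "x \<in> ?I (x mod 3)"
      by (intro image_eqI[of _ _ "x div 3"]) (simp_all add: part_def)
    moreover have "x mod 3 = 0 \<or> x mod 3 = 1 \<or> x mod 3 = 2" by presburger
    ultimately show "x \<in> ?I 0 \<union> ?I 1 \<union> ?I 2" by (elim disjE) simp_all
  qed (auto simp: part_def)
  have c: "card (?I i) = card (part X i)" for i
    by (rule card_image) (auto simp: inj_on_def)
  have "?I 0 \<inter> ?I 1 = {}" "(?I 0 \<union> ?I 1) \<inter> ?I 2 = {}"
    by (auto; presburger)+
  then show ?thesis
    using assms by (subst X) (simp only: card_Un_disjoint c finite_UnI finite_imageI finite_part)
qed

text \<open>The recursion behind all degree counts: inside its own part a vertex beats what its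
  prefix beats, it beats the next part entirely and the previous one not at all.\<close>

lemma card_beaten_digit:
  assumes "finite X" "i < 3"
  shows "card (beaten X (3 * u + i)) =
    card (beaten (part X i) u) + card (part X (Suc i mod 3))"
proof -
  have "part (beaten X (3 * u + i)) j =
      (if j = i then beaten (part X i) u else if j = Suc i mod 3 then part X j else {})"
    if "j < 3" for j
    using that assms by (auto simp: part_def beaten_def beats_digit)
  moreover have "i = 0 \<or> i = 1 \<or> i = 2" using assms by auto
  ultimately show ?thesis
    using card_parts[of "beaten X (3 * u + i)"] assms by (auto simp flip: numeral_2_eq_2)
qed

section \<open>The common out-degree of the full tournament\<close>

definition half :: "nat \<Rightarrow> nat" where
  "half k = (3 ^ k - 1) div 2"

lemma two_half: "2 * half k + 1 = 3 ^ k"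
proof -
  have "odd ((3::nat) ^ k)" by simp
  then obtain m :: nat where "3 ^ k = 2 * m + 1" by (rule oddE)
  then show ?thesis by (simp add: half_def)
qed

lemma half_Suc: "half (Suc k) = 3 * half k + 1"
  using two_half[of k] two_half[of "Suc k"] by simp

lemma half_0 [simp]: "half 0 = 0"
  by (simp add: half_def)

lemma le_half: "k \<le> half k"
  by (induction k) (auto simp: half_Suc)

lemma card_beaten_lessThan:
  "v < 3 ^ k \<Longrightarrow> card (beaten {..<3 ^ k} v) = half k"
proof (induction k arbitrary: v)
  case 0
  then show ?case by (auto simp: beaten_def)
next
  case (Suc k)
  have "v = 3 * (v div 3) + v mod 3" "v div 3 < 3 ^ k" using Suc.prems by auto
  then have "card (beaten {..<3 ^ Suc k} v) = half k + 3 ^ k"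
    using card_beaten_digit[of "{..<3 ^ Suc k}" "v mod 3" "v div 3"] Suc.IH
    by (simp del: power_Suc add: part_lessThan)
  then show ?case
    using two_half[of k] by (simp add: half_Suc)
qed

lemma card_beaten_le_half:
  assumes "X \<subseteq> {..<3 ^ k}" "v < 3 ^ k"
  shows "card (beaten X v) \<le> half k"
proof -
  have "beaten X v \<subseteq> beaten {..<3 ^ k} v" using assms(1) by (auto simp: beaten_def)
  then show ?thesis
    using card_mono[of "beaten {..<3 ^ k} v"] card_beaten_lessThan[OF assms(2)] by simp
qed

section \<open>Low out-degree in small sets\<close>

lemma card_beaten_mono:
  assumes "finite X" "Y \<subseteq> X"
  shows "card (beaten X v) \<le> card (beaten Y v) + (card X - card Y)"
proof -
  have "beaten X v \<subseteq> beaten Y v \<union> (X - Y)" by (auto simp: beaten_def)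
  then have "card (beaten X v) \<le> card (beaten Y v \<union> (X - Y))"
    using assms by (intro card_mono) (auto dest: finite_subset)
  also have "\<dots> \<le> card (beaten Y v) + card (X - Y)" by (rule card_Un_le)
  finally show ?thesis
    using assms by (simp add: card_Diff_subset finite_subset)
qed

text \<open>The subtraction is truncated: the last summand vanishes for small \<open>X\<close>.\<close>

lemma small_out_degree:
  assumes "X \<subseteq> {..<3 ^ k}" "X \<noteq> {}"
  shows "\<exists>v\<in>X. 2 * card (beaten X v) + k \<le> half k + 2 * (card X - half k)"
  using assms
proof (induction k arbitrary: X)
  case 0
  then have "X = {0}" by auto
  moreover have "beaten {0} 0 = {}" by (auto simp: beaten_def)
  ultimately show ?case by simp
next
  case (Suc k)
  define h where "h = half k"
  \<comment> \<open>Sets of at most \<open>half (Suc k)\<close> vertices come first; larger ones are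
    reduced to them at the end.\<close>
  have small: "\<exists>v\<in>Y. 2 * card (beaten Y v) + Suc k \<le> half (Suc k)"
    if Y: "Y \<subseteq> {..<3 ^ Suc k}" "Y \<noteq> {}" and cY: "card Y \<le> half (Suc k)" for Y
  proof -
    define a where "a i = card (part Y i)" for i
    have fin: "finite Y" using Y finite_subset by blast
    have sum: "a 0 + a 1 + a 2 \<le> 3 * h + 1"
      using card_parts[OF fin] cY by (simp add: a_def h_def half_Suc)
    have a0: "part Y i = {} \<longleftrightarrow> a i = 0" for i
      using fin by (simp add: a_def)
    have pos: "0 < a 0 + a 1 + a 2"
      using card_parts[OF fin] Y(2) fin unfolding a_def by (metis card_gt_0_iff)
    have deg: "card (beaten Y (3 * u + i)) = card (beaten (part Y i) u) + a (Suc i mod 3)"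
      if "i < 3" for u i
      using card_beaten_digit[OF fin that] by (simp add: a_def)
    have lt3: "(\<exists>i<3. P i) \<longleftrightarrow> P 0 \<or> P 1 \<or> P (2::nat)" for P
      by (auto simp: numeral_3_eq_3 less_Suc_eq numeral_2_eq_2)
    have mods: "Suc 0 mod 3 = 1" "Suc 1 mod 3 = 2" "Suc 2 mod 3 = 0" by auto
    \<comment> \<open>Suppose all parts are nonempty. If none exceeds h, every i works. If part j
      does, the other two total at most 2h, and i = j + 1 works unless part j + 2 also exceeds h; in
      that case i = j works.\<close>
    have "(\<exists>i<3. a i > 0 \<and> a (Suc i mod 3) = 0) \<or>
        (\<exists>i<3. a i > 0 \<and> a i + a (Suc i mod 3) \<le> 2 * h \<and> a (Suc i mod 3) \<le> h)"
      unfolding lt3 mods using sum pos by linarith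
    then consider i where "i < 3" "a i > 0" "a (Suc i mod 3) = 0"
      | i where "i < 3" "a i > 0" "a i + a (Suc i mod 3) \<le> 2 * h" "a (Suc i mod 3) \<le> h"
      by blast
    then show ?thesis
    proof cases
      case 1
      then obtain u where u: "u \<in> part Y i" using a0[of i] by auto
      have "card (beaten (part Y i) u) \<le> h"
        unfolding h_def using u 1 part_subset[OF _ Y(1), of i] by (intro card_beaten_le_half) auto
      \<comment> \<open>The slack needed is 2h + k + 1 \<le> 3h + 1, that is, k \<le> h.\<close>
      then have "2 * card (beaten Y (3 * u + i)) + Suc k \<le> half (Suc k)"
        using 1 le_half[of k] by (simp add: deg half_Suc h_def)
      with u show ?thesis by (auto simp: part_def)
    next
      case 2
      then have "part Y i \<noteq> {}" using a0[of i] by auto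
      then obtain u where u: "u \<in> part Y i"
        "2 * card (beaten (part Y i) u) + k \<le> h + 2 * (a i - h)"
        using Suc.IH[OF part_subset[OF _ Y(1)]] 2 unfolding a_def h_def by blast
      \<comment> \<open>The two bounds in the choice of i cover the truncated and the genuine value
        of this difference. The degree sum is then at most 3h, and the 1 in 3h + 1 pays for the step
        from k to k + 1.\<close>
      moreover have "(a i - h) + a (Suc i mod 3) \<le> h"
        using 2(3,4) by simp
      ultimately have "2 * card (beaten Y (3 * u + i)) + Suc k \<le> half (Suc k)"
        unfolding deg[OF 2(1)] half_Suc h_def[symmetric] by simp
      with u(1) show ?thesis by (auto simp: part_def)
    qed
  qed
  show ?case
  proof (cases "card X \<le> half (Suc k)")
    case True
    with small[OF Suc.prems] show ?thesis by auto
  next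
    case False
    \<comment> \<open>Each vertex outside Y adds at most one out-neighbour, which is exactly what
      the last summand of the bound allows.\<close>
    then obtain Y where Y: "Y \<subseteq> X" "card Y = half (Suc k)"
      by (metis nat_le_linear obtain_subset_with_card_n)
    moreover have "Y \<noteq> {}" using Y by (auto simp: half_Suc)
    ultimately obtain v where v: "v \<in> Y" "2 * card (beaten Y v) + Suc k \<le> half (Suc k)"
      using small[of Y] Suc.prems by auto
    have "finite X" using Suc.prems finite_subset by blast
    from card_beaten_mono[OF this Y(1), of v] v Y show ?thesis
      by (intro bexI[of _ v]) auto
  qed
qed

section \<open>Translation to digraphs\<close>

definition triangle_power :: "nat \<Rightarrow> (nat, nat \<times> nat) pre_digraph" where
  "triangle_power k = \<lparr>verts = {..<3 ^ k},
     arcs = {(u, v). u < 3 ^ k \<and> v < 3 ^ k \<and> beats u v}, tail = fst, head = snd\<rparr>"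

lemma verts_triangle_power [simp]: "verts (triangle_power k) = {..<3 ^ k}"
  by (simp add: triangle_power_def)

lemma tournament_triangle_power: "tournament (triangle_power k)"
proof
  show "finite (arcs (triangle_power k))"
    by (rule finite_subset[of _ "{..<3 ^ k} \<times> {..<3 ^ k}"]) (auto simp: triangle_power_def)
  fix u v
  assume "u \<in> verts (triangle_power k)" "v \<in> verts (triangle_power k)" "u \<noteq> v"
  moreover have "(u \<rightarrow>\<^bsub>triangle_power k\<^esub> v) \<longleftrightarrow> u < 3 ^ k \<and> v < 3 ^ k \<and> beats u v" for u v
    by (auto simp: triangle_power_def arcs_ends_def arc_to_ends_def image_iff)
  ultimately show "(u \<rightarrow>\<^bsub>triangle_power k\<^esub> v) \<noteq> (v \<rightarrow>\<^bsub>triangle_power k\<^esub> u)"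
    using beats_exactly_one[of u v] by auto
qed (auto simp: triangle_power_def arc_to_ends_def)

lemma out_degree_induce_triangle_power:
  assumes "X \<subseteq> {..<3 ^ k}" "v \<in> X"
  shows "out_degree (triangle_power k \<restriction> X) v = card (beaten X v)"
proof -
  have "out_arcs (triangle_power k \<restriction> X) v = Pair v ` beaten X v"
    using assms by (auto simp: out_arcs_def triangle_power_def induce_subgraph_def beaten_def)
  then show ?thesis
    by (simp add: out_degree_def card_image inj_on_def)
qed

lemma out_degree_triangle_power:
  assumes "v < 3 ^ k"
  shows "out_degree (triangle_power k) v = half k"
proof -
  have "out_arcs (triangle_power k) v = Pair v ` beaten {..<3 ^ k} v"
    using assms by (auto simp: out_arcs_def triangle_power_def beaten_def)
  then show ?thesis
    using card_beaten_lessThan[OF assms] by (simp add: out_degree_def card_image inj_on_def)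
qed

lemma min_out_degree_induce_triangle_power:
  assumes "X \<subseteq> {..<3 ^ k}" "card X \<le> half k"
  shows "2 * min_out_degree (triangle_power k \<restriction> X) + k \<le> half k"
proof (cases "X = {}")
  case True
  \<comment> \<open>The empty digraph has minimum out-degree 0, so k \<le> \<open>half k\<close>
    remains.\<close>
  then show ?thesis by (simp add: min_out_degree_def le_half)
next
  case False
  then obtain v where v: "v \<in> X" "2 * card (beaten X v) + k \<le> half k"
    using small_out_degree[OF assms(1)] assms(2) by auto
  have "finite X" using assms(1) finite_subset by blast
  then have "min_out_degree (triangle_power k \<restriction> X) \<le> card (beaten X v)"
    using v(1) False unfolding out_degree_induce_triangle_power[OF assms(1) v(1), symmetric]
    by (simp add: min_out_degree_def)
  with v(2) show ?thesis by simp
qed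

theorem theorem2:
  fixes k :: nat
  shows "\<exists>T :: (nat, nat \<times> nat) pre_digraph.
    tournament T \<and>
    card (verts T) = 3 ^ k \<and>
    (\<forall>v \<in> verts T. real (out_degree T v) = (3 ^ k - 1) / 2) \<and>
    (\<forall>X. X \<subseteq> verts T \<and> real (card X) \<le> (3 ^ k - 1) / 2 \<longrightarrow>
      real (min_out_degree (T \<restriction> X)) \<le> ((3 ^ k - 1) / 2 - real k) / 2)"
proof (intro exI[of _ "triangle_power k"] conjI allI impI ballI)
  have "real (2 * half k + 1) = 3 ^ k"
    unfolding two_half by simp
  then have half: "(3 ^ k - 1) / 2 = real (half k)" by simp
  show "tournament (triangle_power k)" by (rule tournament_triangle_power)
  show "card (verts (triangle_power k)) = 3 ^ k" by simp
  show "real (out_degree (triangle_power k) v) = (3 ^ k - 1) / 2"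
    if "v \<in> verts (triangle_power k)" for v
    using that by (simp add: half out_degree_triangle_power)
  show "real (min_out_degree (triangle_power k \<restriction> X)) \<le> ((3 ^ k - 1) / 2 - real k) / 2"
    if "X \<subseteq> verts (triangle_power k) \<and> real (card X) \<le> (3 ^ k - 1) / 2" for X
    using that min_out_degree_induce_triangle_power[of X k] unfolding half by simp
qed

end
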